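(* Let $D$ be a PVMD that is a $t$-QR domain. Then $D$ is completely integrally closed if and only if $D$ is Archimedean.
   Context: $D$ is an integral domain with quotient field $K$. For an integral domain $R$ with quotient field $K$ and a nonzero fractional ideal $I$ of $R$ put $I^{-1}=\{x\in K\mid xI\subseteq R\}$, $I_v=(I^{-1})^{-1}$, and $I_t=\bigcup\{J_v\mid J\subseteq I,\ J \text{ a nonzero finitely generated fractional ideal}\}$. $D$ is a PVMD (Prüfer $v$-multiplication domain) if $(II^{-1})_t=D$ for every nonzero finitely generated ideal $I$ of $D$. An overring $R$ of $D$ ($D\subseteq R\subseteq K$) is $t$-linked over $D$ if for every nonzero finitely generated ideal $A$ of $D$, $A^{-1}=D$ implies $(AR)^{-1}=R$ (the latter inverse taken with respect to $R$). $D$ is a $t$-QR domain if every $t$-linked overring of $D$ is a quotient ring of $D$, i.e. a localization $D_T$ at a multiplicative subset $T$ of $D$. $D$ is completely integrally closed if whenever $x\in K$ and $0\ne r\in D$ satisfy $rx^n\in D$ for every integer $n\ge1$, then $x\in D$. $D$ is Archimedean if $\bigcap_{n=1}^{\infty}(x^n)=(0)$ for every nonunit $x\in D$. *)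

theory Defs
  imports Complex_Main
begin

text \<open>
  Everything lives inside a field \<open>K\<close>, given by the type \<open>'k\<close>. A domain with quotient field \<open>K\<close> is
  a subset of \<open>K\<close>, and so are its fractional ideals and its overrings.
\<close>

definition is_subring :: "'k::field set \<Rightarrow> bool" where
  "is_subring R \<longleftrightarrow> 1 \<in> R \<and> (\<forall>x\<in>R. \<forall>y\<in>R. x - y \<in> R \<and> x * y \<in> R)"

text \<open>\<open>R\<close> is an integral domain whose quotient field is the whole of \<open>K\<close>.\<close>

definition is_domain :: "'k::field set \<Rightarrow> bool" where
  "is_domain R \<longleftrightarrow> is_subring R \<and> (\<forall>x. \<exists>a\<in>R. \<exists>b\<in>R. b \<noteq> 0 \<and> x = a / b)"

definition is_submodule :: "'k::field set \<Rightarrow> 'k set \<Rightarrow> bool" where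
  "is_submodule R I \<longleftrightarrow> 0 \<in> I \<and> (\<forall>x\<in>I. \<forall>y\<in>I. x + y \<in> I) \<and> (\<forall>r\<in>R. \<forall>x\<in>I. r * x \<in> I)"

text \<open>
  The \<open>R\<close>-submodule of \<open>K\<close> generated by \<open>S\<close>. It is used for finitely generated and principal
  ideals, for products, and, with an overring in place of \<open>R\<close>, for the extension \<open>A R\<close>.
\<close>

definition gen :: "'k::field set \<Rightarrow> 'k set \<Rightarrow> 'k set" where
  "gen R S = is_submodule R hull S"

definition mult :: "'k::field set \<Rightarrow> 'k set \<Rightarrow> 'k set \<Rightarrow> 'k set" where
  "mult R I J = gen R {x * y | x y. x \<in> I \<and> y \<in> J}"

definition fractional_ideal :: "'k::field set \<Rightarrow> 'k set \<Rightarrow> bool" where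
  "fractional_ideal R I \<longleftrightarrow> is_submodule R I \<and> (\<exists>d\<in>R. d \<noteq> 0 \<and> (\<forall>x\<in>I. d * x \<in> R))"

definition fin_gen :: "'k::field set \<Rightarrow> 'k set \<Rightarrow> bool" where
  "fin_gen R I \<longleftrightarrow> (\<exists>S. finite S \<and> I = gen R S)"

definition nonzero_fg_fractional_ideal :: "'k::field set \<Rightarrow> 'k set \<Rightarrow> bool" where
  "nonzero_fg_fractional_ideal R I \<longleftrightarrow> fractional_ideal R I \<and> I \<noteq> {0} \<and> fin_gen R I"

definition nonzero_fg_ideal :: "'k::field set \<Rightarrow> 'k set \<Rightarrow> bool" where
  "nonzero_fg_ideal R I \<longleftrightarrow> is_submodule R I \<and> I \<subseteq> R \<and> I \<noteq> {0} \<and> fin_gen R I"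

definition inv_ideal :: "'k::field set \<Rightarrow> 'k set \<Rightarrow> 'k set" where
  "inv_ideal R I = {x. \<forall>y\<in>I. x * y \<in> R}"

definition v_closure :: "'k::field set \<Rightarrow> 'k set \<Rightarrow> 'k set" where
  "v_closure R I = inv_ideal R (inv_ideal R I)"

definition t_closure :: "'k::field set \<Rightarrow> 'k set \<Rightarrow> 'k set" where
  "t_closure R I = \<Union> {v_closure R J | J. J \<subseteq> I \<and> nonzero_fg_fractional_ideal R J}"

definition PVMD :: "'k::field set \<Rightarrow> bool" where
  "PVMD D \<longleftrightarrow> is_domain D \<and>
     (\<forall>I. nonzero_fg_ideal D I \<longrightarrow> t_closure D (mult D I (inv_ideal D I)) = D)"

definition overring :: "'k::field set \<Rightarrow> 'k set \<Rightarrow> bool" where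
  "overring D R \<longleftrightarrow> is_subring R \<and> D \<subseteq> R"

definition t_linked :: "'k::field set \<Rightarrow> 'k set \<Rightarrow> bool" where
  "t_linked D R \<longleftrightarrow> overring D R \<and>
     (\<forall>A. nonzero_fg_ideal D A \<longrightarrow> inv_ideal D A = D \<longrightarrow> inv_ideal R (gen R A) = R)"

text \<open>Excluding 0 from \<open>T\<close> is what makes the localization a subring of \<open>K\<close>.\<close>

definition multiplicative_subset :: "'k::field set \<Rightarrow> 'k set \<Rightarrow> bool" where
  "multiplicative_subset D T \<longleftrightarrow> T \<subseteq> D \<and> 1 \<in> T \<and> 0 \<notin> T \<and> (\<forall>s\<in>T. \<forall>t\<in>T. s * t \<in> T)"

definition localization :: "'k::field set \<Rightarrow> 'k set \<Rightarrow> 'k set" where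
  "localization D T = {a / t | a t. a \<in> D \<and> t \<in> T}"

definition t_QR :: "'k::field set \<Rightarrow> bool" where
  "t_QR D \<longleftrightarrow> is_domain D \<and>
     (\<forall>R. t_linked D R \<longrightarrow> (\<exists>T. multiplicative_subset D T \<and> R = localization D T))"

definition completely_integrally_closed :: "'k::field set \<Rightarrow> bool" where
  "completely_integrally_closed D \<longleftrightarrow>
     (\<forall>x r. r \<in> D \<and> r \<noteq> 0 \<and> (\<forall>n\<ge>1::nat. r * x ^ n \<in> D) \<longrightarrow> x \<in> D)"

definition is_unit_of :: "'k::field set \<Rightarrow> 'k \<Rightarrow> bool" where
  "is_unit_of D x \<longleftrightarrow> x \<in> D \<and> (\<exists>y\<in>D. x * y = 1)"

definition archimedean :: "'k::field set \<Rightarrow> bool" where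
  "archimedean D \<longleftrightarrow> (\<forall>x\<in>D. \<not> is_unit_of D x \<longrightarrow> (\<Inter>n\<in>{1::nat..}. gen D {x ^ n}) = {0})"

end

theory Submission
  imports Defs
begin

text \<open>
  Completely integrally closed domains are Archimedean because \<open>0 \<noteq> r \<in> \<Inter>(x\<^sup>n)\<close> makes \<open>x\<inverse>\<close> almost
  integral. Conversely, let \<open>r x\<^sup>n \<in> D\<close> for all \<open>n\<close> with \<open>r \<noteq> 0\<close>, suppose \<open>x \<notin> D\<close>, and put
  \<open>A = (1, x)\<inverse> = {d \<in> D. d x \<in> D}\<close>. The Nagata transform \<open>R = \<Union>\<^sub>n (A\<^sup>n)\<inverse>\<close> is \<open>t\<close>-linked, hence
  \<open>R = D\<^sub>T\<close>. As \<open>x \<in> R\<close>, some \<open>t \<in> T\<close> lies in \<open>A\<close>, so \<open>t\<close> is not a unit, and \<open>1/t \<in> R\<close> means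
  \<open>A\<^sup>n \<subseteq> (t)\<close> for some \<open>n\<close>. Since \<open>(1, x)\<close> is \<open>t\<close>-invertible and \<open>r (1, x)\<^sup>n\<^sup>m \<subseteq> D\<close>, the element \<open>r\<close> lies
  in \<open>(A\<^sup>n\<^sup>m)\<^sub>v \<subseteq> (t\<^sup>m)\<close> for every \<open>m\<close>, so \<open>D\<close> is not Archimedean.
\<close>

section \<open>Submodules of the field and their conductors\<close>

lemma is_subring_uminus:
  assumes "is_subring D" "x \<in> D"
  shows "- x \<in> D"
proof -
  have "1 - 1 \<in> D" using assms unfolding is_subring_def by blast
  then have "0 - x \<in> D" using assms unfolding is_subring_def by fastforce
  then show ?thesis by simp
qed

lemma is_subringD:
  assumes "is_subring D"
  shows "0 \<in> D" "1 \<in> D"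
    and "\<And>x y. x \<in> D \<Longrightarrow> y \<in> D \<Longrightarrow> x - y \<in> D"
    and "\<And>x y. x \<in> D \<Longrightarrow> y \<in> D \<Longrightarrow> x + y \<in> D"
    and "\<And>x y. x \<in> D \<Longrightarrow> y \<in> D \<Longrightarrow> x * y \<in> D"
proof -
  show 1: "1 \<in> D" and diff: "\<And>x y. x \<in> D \<Longrightarrow> y \<in> D \<Longrightarrow> x - y \<in> D"
    and "\<And>x y. x \<in> D \<Longrightarrow> y \<in> D \<Longrightarrow> x * y \<in> D"
    using assms unfolding is_subring_def by blast+
  show "0 \<in> D" using diff[OF 1 1] by simp
  show "x + y \<in> D" if "x \<in> D" "y \<in> D" for x y
    using diff[OF that(1) is_subring_uminus[OF assms that(2)]] by simp
qed

lemma is_submodule_gen: "is_submodule D (gen D S)"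
  unfolding gen_def is_submodule_def hull_def by blast

lemma gen_superset: "S \<subseteq> gen D S"
  unfolding gen_def by (rule hull_subset)

lemma gen_minimal: "S \<subseteq> M \<Longrightarrow> is_submodule D M \<Longrightarrow> gen D S \<subseteq> M"
  unfolding gen_def by (rule hull_minimal)

lemma gen_singleton: "is_subring D \<Longrightarrow> gen D {x} = {d * x | d. d \<in> D}"
proof
  assume D: "is_subring D"
  have "is_submodule D {d * x | d. d \<in> D}"
    unfolding is_submodule_def
  proof (intro conjI ballI)
    show "0 \<in> {d * x | d. d \<in> D}" using is_subringD(1)[OF D] by force
    show "u + v \<in> {d * x | d. d \<in> D}" if "u \<in> {d * x | d. d \<in> D}" "v \<in> {d * x | d. d \<in> D}" for u v
      using that is_subringD(4)[OF D] by (auto simp: distrib_right[symmetric])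
    show "c * u \<in> {d * x | d. d \<in> D}" if "c \<in> D" "u \<in> {d * x | d. d \<in> D}" for c u
      using that is_subringD(5)[OF D] by (auto simp: mult.assoc[symmetric])
  qed
  then show "gen D {x} \<subseteq> {d * x | d. d \<in> D}"
    using is_subringD(2)[OF D] by (intro gen_minimal) force+
  show "{d * x | d. d \<in> D} \<subseteq> gen D {x}"
    using is_submodule_gen[of D "{x}"] gen_superset[of "{x}" D] unfolding is_submodule_def by blast
qed

lemma is_submodule_conductor:
  assumes "is_subring D"
  shows "is_submodule D {u. y * u \<in> D}"
  using is_subringD[OF assms] unfolding is_submodule_def
  by (auto simp: distrib_left mult.left_commute)

lemma gen_conductor:
  assumes "is_subring D" "\<And>s. s \<in> S \<Longrightarrow> y * s \<in> D" "u \<in> gen D S"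
  shows "y * u \<in> D"
  using gen_minimal[OF _ is_submodule_conductor[OF assms(1)], of S y] assms(2,3) by blast

section \<open>Products of ideal elements and the Nagata transform\<close>

text \<open>These products generate the ideal power A^n. Since y A^n \<subseteq> D can be tested on
  generators, sums never have to be formed.\<close>

primrec power_products :: "'k::field set \<Rightarrow> nat \<Rightarrow> 'k set" where
  "power_products A 0 = {1}"
| "power_products A (Suc n) = {a * p | a p. a \<in> A \<and> p \<in> power_products A n}"

lemma power_products_addE:
  assumes "p \<in> power_products A (m + n)"
  obtains u v where "u \<in> power_products A m" "v \<in> power_products A n" "p = u * v"
proof -
  have "\<exists>u\<in>power_products A m. \<exists>v\<in>power_products A n. p = u * v"
    using assms
  proof (induction m arbitrary: p)
    case 0
    then show ?case by simp
  next
    case (Suc m)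
    then obtain a q where a: "a \<in> A" "q \<in> power_products A (m + n)" "p = a * q" by auto
    with Suc.IH obtain u v where "u \<in> power_products A m" "v \<in> power_products A n" "q = u * v"
      by blast
    with a show ?case by (intro bexI[of _ "a * u"] bexI[of _ v]) (auto simp: mult.assoc)
  qed
  then show thesis using that by blast
qed

lemma power_products_subset:
  assumes "is_subring D" "A \<subseteq> D"
  shows "power_products A n \<subseteq> D"
proof (induction n)
  case 0
  then show ?case using is_subringD(2)[OF assms(1)] by simp
next
  case (Suc n)
  then show ?case using is_subringD(5)[OF assms(1)] assms(2) by auto
qed

definition nagata_transform :: "'k::field set \<Rightarrow> 'k set \<Rightarrow> 'k set" where
  "nagata_transform D A = {y. \<exists>n. \<forall>p\<in>power_products A n. y * p \<in> D}"

text \<open>Surplus factors from \<open>A\<close> lie in \<open>D\<close> and are absorbed, so the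
  conductors (A^n)^-1 increase with n. This lets several exponents be replaced by a common
  one.\<close>

lemma power_products_conductor_mono:
  assumes "is_subring D" "A \<subseteq> D" "\<forall>p\<in>power_products A n. y * p \<in> D" "n \<le> m"
  shows "\<forall>p\<in>power_products A m. y * p \<in> D"
proof
  fix p assume "p \<in> power_products A m"
  with \<open>n \<le> m\<close> have "p \<in> power_products A (n + (m - n))" by simp
  then obtain u v where "u \<in> power_products A n" "v \<in> power_products A (m - n)" "p = u * v"
    by (rule power_products_addE)
  then show "y * p \<in> D"
    using assms(3) power_products_subset[OF assms(1,2)] is_subringD(5)[OF assms(1)]
    by (metis mult.assoc subsetD)
qed

lemma is_subring_nagata_transform:
  assumes D: "is_subring D" and A: "A \<subseteq> D"
  shows "is_subring (nagata_transform D A)"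
  unfolding is_subring_def
proof (intro conjI ballI)
  show "1 \<in> nagata_transform D A"
    unfolding nagata_transform_def using is_subringD(2)[OF D] by (auto intro: exI[of _ 0])
next
  fix y z assume "y \<in> nagata_transform D A" "z \<in> nagata_transform D A"
  then obtain m n where m: "\<forall>p\<in>power_products A m. y * p \<in> D"
    and n: "\<forall>p\<in>power_products A n. z * p \<in> D"
    unfolding nagata_transform_def by blast
  have "\<forall>p\<in>power_products A (m + n). (y - z) * p \<in> D"
    using power_products_conductor_mono[OF D A m, of "m + n"]
      power_products_conductor_mono[OF D A n, of "m + n"] is_subringD(3)[OF D]
    by (simp add: left_diff_distrib)
  then show "y - z \<in> nagata_transform D A" unfolding nagata_transform_def by blast
  have "(y * z) * p \<in> D" if "p \<in> power_products A (m + n)" for p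
  proof -
    obtain u v where "u \<in> power_products A m" "v \<in> power_products A n" "p = u * v"
      using \<open>p \<in> _\<close> by (rule power_products_addE)
    then have "(y * u) * (z * v) \<in> D" using m n is_subringD(5)[OF D] by blast
    then show ?thesis using \<open>p = u * v\<close> by (simp add: ac_simps)
  qed
  then show "y * z \<in> nagata_transform D A" unfolding nagata_transform_def by blast
qed

lemma subset_nagata_transform: "D \<subseteq> nagata_transform D A"
  unfolding nagata_transform_def by (auto intro: exI[of _ 0])

text \<open>If y multiplies B into the transform, each of the finitely many generators s of B has an
  n with y s A^n \<subseteq> D. A common n gives y A^n \<subseteq> B^-1 = D, so y is in the
  transform.\<close>

lemma t_linked_nagata_transform:
  assumes D: "is_subring D" and A: "A \<subseteq> D"
  shows "t_linked D (nagata_transform D A)"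
  unfolding t_linked_def overring_def
proof (intro conjI allI impI)
  let ?R = "nagata_transform D A"
  show R: "is_subring ?R" by (rule is_subring_nagata_transform[OF D A])
  show DR: "D \<subseteq> ?R" by (rule subset_nagata_transform)
  fix B assume B: "nonzero_fg_ideal D B" and inv: "inv_ideal D B = D"
  from B obtain S where S: "finite S" "B = gen D S" and BD: "B \<subseteq> D"
    unfolding nonzero_fg_ideal_def fin_gen_def by blast
  show "inv_ideal ?R (gen ?R B) = ?R"
  proof
    show "?R \<subseteq> inv_ideal ?R (gen ?R B)"
      unfolding inv_ideal_def
      using gen_conductor[OF R] is_subringD(5)[OF R] BD DR by blast
  next
    show "inv_ideal ?R (gen ?R B) \<subseteq> ?R"
    proof
      fix y assume y: "y \<in> inv_ideal ?R (gen ?R B)"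
      have "\<forall>s\<in>S. \<exists>n. \<forall>p\<in>power_products A n. (y * s) * p \<in> D"
        using y gen_superset[of B ?R] gen_superset[of S D] S(2)
        unfolding inv_ideal_def nagata_transform_def by blast
      then obtain f where f: "\<forall>s\<in>S. \<forall>p\<in>power_products A (f s). (y * s) * p \<in> D"
        by metis
      \<comment> \<open>Any common upper bound of the exponents will do; the sum is one because they
        are natural numbers.\<close>
      define n where "n = (\<Sum>s\<in>S. f s)"
      have n: "(y * p) * s \<in> D" if "s \<in> S" "p \<in> power_products A n" for s p
      proof -
        have "f s \<le> n" unfolding n_def using S(1) that(1) by (simp add: member_le_sum)
        then have "(y * s) * p \<in> D"
          using power_products_conductor_mono[OF D A] f that by blast
        then show ?thesis by (simp add: ac_simps)
      qed
      have "y * p \<in> inv_ideal D B" if "p \<in> power_products A n" for p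
        unfolding inv_ideal_def S(2) using gen_conductor[OF D n] that by blast
      then show "y \<in> ?R" unfolding inv nagata_transform_def by blast
    qed
  qed
qed

section \<open>Cancelling powers of (1, x) and its inverse\<close>

text \<open>
  The colon ideal \<open>(1, x)\<inverse>\<close>; the next lemma says that \<open>(1, x)\<close> is \<open>t\<close>-invertible, in the form
  \<open>((1, x) (1, x)\<inverse>)\<inverse> = D\<close>.
\<close>

definition denominators :: "'k::field set \<Rightarrow> 'k \<Rightarrow> 'k set" where
  "denominators D x = {d \<in> D. d * x \<in> D}"

lemma PVMD_denominators_cancel:
  assumes "PVMD D"
    and y: "\<And>a. a \<in> denominators D x \<Longrightarrow> y * a \<in> D"
      "\<And>a. a \<in> denominators D x \<Longrightarrow> y * x * a \<in> D"
  shows "y \<in> D"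
proof -
  have D: "is_subring D" using assms unfolding PVMD_def is_domain_def by blast
  obtain a b where ab: "a \<in> D" "b \<in> D" "b \<noteq> 0" "x = a / b"
    using assms unfolding PVMD_def is_domain_def by blast
  \<comment> \<open>Clearing the denominator of \<open>x\<close> turns (1, x) into the integral
    ideal (a, b) = b (1, x), to which the PVMD condition applies.\<close>
  define I where "I = gen D {a, b}"
  have abI: "a \<in> I" "b \<in> I" using gen_superset[of "{a, b}" D] unfolding I_def by auto
  have "I \<subseteq> D"
    using gen_conductor[OF D, of "{a, b}" 1] ab unfolding I_def by auto
  then have "nonzero_fg_ideal D I"
    using ab(3) abI(2) is_submodule_gen[of D "{a, b}"]
    unfolding nonzero_fg_ideal_def fin_gen_def I_def
    by (auto intro!: exI[of _ "{a, b}"])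
  then have "t_closure D (mult D I (inv_ideal D I)) = D"
    using assms unfolding PVMD_def by blast
  then obtain J where J: "J \<subseteq> mult D I (inv_ideal D I)" "1 \<in> v_closure D J"
    using is_subringD(2)[OF D] unfolding t_closure_def by blast
  have yiz: "y * (i * z) \<in> D" if "i \<in> I" "z \<in> inv_ideal D I" for i z
  proof -
    have "z * b \<in> D" "z * a \<in> D" using that abI unfolding inv_ideal_def by blast+
    \<comment> \<open>Here \<open>z * b * x = z * a\<close>. The two assumptions on
      \<open>y\<close>, applied to \<open>z * b\<close>, say that \<open>y * z\<close> multiplies
      both generators of \<open>I\<close> into \<open>D\<close>.\<close>
    then have "z * b \<in> denominators D x" using ab unfolding denominators_def by simp
    then have "y * (z * b) \<in> D" "y * x * (z * b) \<in> D" using y by blast+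
    then have "(y * z) * s \<in> D" if "s \<in> {a, b}" for s
      using that ab by (auto simp: ac_simps)
    then have "(y * z) * i \<in> D" using gen_conductor[OF D] \<open>i \<in> I\<close> unfolding I_def by blast
    then show ?thesis by (simp add: ac_simps)
  qed
  have "y * u \<in> D" if "u \<in> mult D I (inv_ideal D I)" for u
    using that unfolding mult_def by (rule gen_conductor[OF D, rotated]) (use yiz in blast)
  \<comment> \<open>Now \<open>y\<close> lies in J^-1 while 1 lies in (J^-1)^-1, so their product
    lies in \<open>D\<close>.\<close>
  then have "y \<in> inv_ideal D J" using J(1) unfolding inv_ideal_def by blast
  then have "1 * y \<in> D" using J(2) unfolding v_closure_def inv_ideal_def by blast
  then show ?thesis by simp
qed

text \<open>The powers x^i with i \<le> N generate (1, x)^N, so the hypothesis says that s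
  multiplies (1, x)^N A^N into D for A = (1, x)^-1. The induction cancels one factor (1, x) A at a
  time.\<close>

lemma PVMD_denominators_power_cancel:
  assumes "PVMD D"
    and "\<And>i p. i \<le> N \<Longrightarrow> p \<in> power_products (denominators D x) N \<Longrightarrow> s * x ^ i * p \<in> D"
  shows "s \<in> D"
  using assms(2)
proof (induction N)
  case 0
  then show ?case using 0[of 0 1] by simp
next
  case (Suc N)
  show ?case
  proof (rule Suc.IH)
    fix i p assume i: "i \<le> N" and p: "p \<in> power_products (denominators D x) N"
    show "s * x ^ i * p \<in> D"
    \<comment> \<open>The two premises raise the exponent of \<open>x\<close> to \<open>i\<close>
      and \<open>Suc i\<close>, both at most \<open>Suc N\<close>.\<close>
    proof (rule PVMD_denominators_cancel[OF assms(1)])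
      fix a assume "a \<in> denominators D x"
      then have ap: "a * p \<in> power_products (denominators D x) (Suc N)" using p by auto
      show "s * x ^ i * p * a \<in> D" "s * x ^ i * p * x * a \<in> D"
        using Suc.prems[OF _ ap, of i] Suc.prems[OF _ ap, of "Suc i"] i by (simp_all add: ac_simps)
    qed
  qed
qed

lemma power_products_mult_divisible:
  assumes "is_subring D" "\<forall>p\<in>power_products A n. p / t \<in> D"
  shows "\<forall>p\<in>power_products A (m * n). p / t ^ m \<in> D"
proof (induction m)
  case 0
  then show ?case using is_subringD(2)[OF assms(1)] by simp
next
  case (Suc m)
  show ?case
  proof
    fix p assume "p \<in> power_products A (Suc m * n)"
    then have "p \<in> power_products A (n + m * n)" by simp
    then obtain u v where uv: "u \<in> power_products A n" "v \<in> power_products A (m * n)" "p = u * v"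
      by (rule power_products_addE)
    then have "(u / t) * (v / t ^ m) \<in> D"
      using Suc assms is_subringD(5)[OF assms(1)] by blast
    then show "p / t ^ Suc m \<in> D" using uv by simp
  qed
qed

section \<open>The two implications\<close>

lemma completely_integrally_closed_imp_archimedean:
  assumes D: "is_subring D" and "completely_integrally_closed D"
  shows "archimedean D"
  unfolding archimedean_def
proof (intro ballI impI)
  fix x assume x: "x \<in> D" "\<not> is_unit_of D x"
  have "r = 0" if r: "r \<in> (\<Inter>n\<in>{1::nat..}. gen D {x ^ n})" for r
  proof (rule ccontr)
    assume "r \<noteq> 0"
    have rD: "\<exists>d\<in>D. r = d * x ^ n" if "n \<ge> 1" for n
      using r that unfolding gen_singleton[OF D] by auto
    have "x \<noteq> 0" using rD[of 1] \<open>r \<noteq> 0\<close> by auto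
    have "r * (1 / x) ^ n \<in> D" if "n \<ge> 1" for n
      using rD[OF that] \<open>x \<noteq> 0\<close> by (auto simp: power_divide)
    moreover have "r \<in> D"
      using rD[of 1] x(1) is_subringD(5)[OF D] by auto
    ultimately have "1 / x \<in> D"
      using assms(2) \<open>r \<noteq> 0\<close> unfolding completely_integrally_closed_def by blast
    then show False using x \<open>x \<noteq> 0\<close> unfolding is_unit_of_def by force
  qed
  moreover have "0 \<in> gen D {x ^ n}" for n
    using is_submodule_gen[of D] unfolding is_submodule_def by blast
  ultimately show "(\<Inter>n\<in>{1::nat..}. gen D {x ^ n}) = {0}" by blast
qed

lemma archimedean_imp_completely_integrally_closed:
  assumes "PVMD D" "t_QR D" "archimedean D"
  shows "completely_integrally_closed D"
  unfolding completely_integrally_closed_def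
proof (intro allI impI)
  have D: "is_subring D" using assms(1) unfolding PVMD_def is_domain_def by blast
  fix x r assume "r \<in> D \<and> r \<noteq> 0 \<and> (\<forall>n\<ge>1::nat. r * x ^ n \<in> D)"
  then have "r \<in> D" "r \<noteq> 0" and "\<And>n. n \<ge> 1 \<Longrightarrow> r * x ^ n \<in> D" by blast+
  \<comment> \<open>The exponent 0 is included because the cancellation below runs over all powers
    of \<open>x\<close> from 0 on.\<close>
  then have rx: "r * x ^ n \<in> D" for n by (cases "n = 0") auto
  show "x \<in> D"
  proof (rule ccontr)
    assume "x \<notin> D"
    define A where "A = denominators D x"
    have A: "A \<subseteq> D" unfolding A_def denominators_def by blast
    obtain T where T: "multiplicative_subset D T" "nagata_transform D A = localization D T"
      using assms(2) t_linked_nagata_transform[OF D A] unfolding t_QR_def by blast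
    have "\<forall>p\<in>power_products A 1. x * p \<in> D"
      unfolding A_def denominators_def by (auto simp: mult.commute)
    then have "x \<in> localization D T" using T(2) unfolding nagata_transform_def by blast
    then obtain d t where dt: "d \<in> D" "t \<in> T" "x = d / t" unfolding localization_def by blast
    have t: "t \<in> D" "t \<noteq> 0" using T(1) dt(2) unfolding multiplicative_subset_def by blast+
    have "t * x \<in> D" using dt t by simp
    have "\<not> is_unit_of D t"
    proof
      assume "is_unit_of D t"
      then obtain u where "u \<in> D" "t * u = 1" unfolding is_unit_of_def by blast
      moreover have "u * (t * x) = (t * u) * x" by (simp add: ac_simps)
      ultimately show False
        using \<open>t * x \<in> D\<close> \<open>x \<notin> D\<close> is_subringD(5)[OF D, of u "t * x"]
        by (metis mult_1)
    qed
    \<comment> \<open>The equality with the localization is used a second time: inverting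
      \<open>t\<close> yields some n with A^n \<subseteq> (t).\<close>
    have "1 / t \<in> nagata_transform D A"
      using T(2) dt(2) is_subringD(2)[OF D] unfolding localization_def by blast
    then obtain n where n: "\<forall>p\<in>power_products A n. p / t \<in> D"
      unfolding nagata_transform_def by auto
    have "r \<in> gen D {t ^ m}" for m
    proof -
      have "r / t ^ m \<in> D"
      \<comment> \<open>Apply the cancellation to s = r / t^m with N = m n: each s x^i p splits as
        (r x^i) (p / t^m), and both factors lie in \<open>D\<close>.\<close>
      proof (rule PVMD_denominators_power_cancel[OF assms(1), of "m * n" x])
        fix i p assume "p \<in> power_products (denominators D x) (m * n)"
        then have "(r * x ^ i) * (p / t ^ m) \<in> D"
          using power_products_mult_divisible[OF D n] rx is_subringD(5)[OF D] unfolding A_def by blast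
        then show "r / t ^ m * x ^ i * p \<in> D" by simp
      qed
      then show ?thesis
        unfolding gen_singleton[OF D] using t(2) by (auto intro!: exI[of _ "r / t ^ m"])
    qed
    then have "r \<in> (\<Inter>n\<in>{1::nat..}. gen D {t ^ n})" by blast
    then have "r = 0"
      using assms(3) t(1) \<open>\<not> is_unit_of D t\<close> unfolding archimedean_def by blast
    then show False using \<open>r \<noteq> 0\<close> by contradiction
  qed
qed

theorem corollary2p11:
  fixes D :: "'k::field set"
  assumes "is_domain D"
    and "PVMD D"
    and "t_QR D"
  shows "completely_integrally_closed D \<longleftrightarrow> archimedean D"
  using assms completely_integrally_closed_imp_archimedean
    archimedean_imp_completely_integrally_closed
  unfolding is_domain_def by blast

end
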